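(* Let $\beta>0$ and let $\mathbf{s}_1,\dots,\mathbf{s}_{N_S}\in\mathcal{C}$, $\mathbf{s}_j=(x'_j,y'_j)$, be sources with strengths $q_1,\dots,q_{N_S}\in\mathbb{R}$. Then for every target $\mathbf{t}=(x,y)\in\mathcal{C}$, the field at $\mathbf{t}$ induced by all sources lying in the image cells to the "south", i.e. those indexed by $\{(m,n)\in\mathbb{Z}^2 : m\in\mathbb{Z},\ n\le -2\}$, satisfies $$\sum_{j=1}^{N_S}\Big(\sum_{m=-\infty}^{\infty}\sum_{n=-\infty}^{-2} G(\mathbf{t},\mathbf{s}_j+\mathbf{l}_{mn})\Big)q_j=\sum_{m=-\infty}^{\infty} c_m\, e^{-\sqrt{(2\pi m/d)^2+\beta^2}\,y}\,e^{2\pi i m x/d},$$ where $$c_m=\frac{1}{2d}\left(\frac{e^{-2\sqrt{(2\pi m/d)^2+\beta^2}\,\eta}\,e^{4\pi i m\xi/d}}{1-e^{-\sqrt{(2\pi m/d)^2+\beta^2}\,\eta}\,e^{2\pi i m\xi/d}}\right)\sum_{j=1}^{N_S}q_j\,\frac{e^{\sqrt{(2\pi m/d)^2+\beta^2}\,y'_j}\,e^{-2\pi i m x'_j/d}}{\sqrt{(2\pi m/d)^2+\beta^2}}.$$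
   Context: Let $d,\eta>0$ and $\xi\in\mathbb{R}$ with $d\ge\sqrt{\xi^2+\eta^2}$, $\mathbf{e}_1=(d,0)$, $\mathbf{e}_2=(\xi,\eta)$. The unit cell is $\mathcal{C}=\{x_1\mathbf{e}_1+x_2\mathbf{e}_2 : x_1,x_2\in[-\tfrac12,\tfrac12]\}\subset\mathbb{R}^2$, and $\mathbf{l}_{mn}=m\mathbf{e}_1+n\mathbf{e}_2$ for $(m,n)\in\mathbb{Z}^2$. The free-space Green's function of the modified Helmholtz equation is $G(\mathbf{t},\mathbf{s})=\frac{1}{2\pi}K_0(\beta\|\mathbf{t}-\mathbf{s}\|)$, where $K_0$ is the modified Bessel function of the second kind of order zero. *)

theory Defs
  imports "HOL-Analysis.Analysis"
begin

text \<open>Modified Bessel function of the second kind of order zero, by its standard integral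
  representation \<open>K\<^sub>0(z) = \<integral>\<^sub>0\<^sup>\<infinity> exp (-z cosh u) du\<close> (DLMF 10.32.9). Only meaningful for
  \<open>z > 0\<close>.\<close>

definition bessel_K0 :: "real \<Rightarrow> real" where
  "bessel_K0 z = (LBINT u:{0..}. exp (- z * cosh u))"

text \<open>The norm on \<^typ>\<open>real \<times> real\<close> is the Euclidean one.\<close>

definition green_fun :: "real \<Rightarrow> real \<times> real \<Rightarrow> real \<times> real \<Rightarrow> real" where
  "green_fun \<beta> t s = 1 / (2 * pi) * bessel_K0 (\<beta> * norm (t - s))"

definition basis1 :: "real \<Rightarrow> real \<times> real" where
  "basis1 d = (d, 0)"

definition basis2 :: "real \<Rightarrow> real \<Rightarrow> real \<times> real" where
  "basis2 \<xi> \<eta> = (\<xi>, \<eta>)"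

definition unit_cell :: "real \<Rightarrow> real \<Rightarrow> real \<Rightarrow> (real \<times> real) set" where
  "unit_cell d \<xi> \<eta> =
     {x1 *\<^sub>R basis1 d + x2 *\<^sub>R basis2 \<xi> \<eta> | x1 x2. x1 \<in> {-1/2..1/2} \<and> x2 \<in> {-1/2..1/2}}"

definition lattice_vec :: "real \<Rightarrow> real \<Rightarrow> real \<Rightarrow> int \<Rightarrow> int \<Rightarrow> real \<times> real" where
  "lattice_vec d \<xi> \<eta> m n = of_int m *\<^sub>R basis1 d + of_int n *\<^sub>R basis2 \<xi> \<eta>"

definition decay_rate :: "real \<Rightarrow> real \<Rightarrow> int \<Rightarrow> real" where
  "decay_rate d \<beta> m = sqrt ((2 * pi * of_int m / d)\<^sup>2 + \<beta>\<^sup>2)"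

definition south_coeff ::
  "real \<Rightarrow> real \<Rightarrow> real \<Rightarrow> real \<Rightarrow> nat \<Rightarrow> (nat \<Rightarrow> real \<times> real) \<Rightarrow> (nat \<Rightarrow> real) \<Rightarrow> int \<Rightarrow> complex" where
  "south_coeff d \<xi> \<eta> \<beta> N s q m =
     1 / (2 * complex_of_real d) *
     (complex_of_real (exp (- 2 * decay_rate d \<beta> m * \<eta>)) *
        exp (4 * complex_of_real pi * \<i> * of_int m * complex_of_real \<xi> / complex_of_real d) /
      (1 - complex_of_real (exp (- decay_rate d \<beta> m * \<eta>)) *
        exp (2 * complex_of_real pi * \<i> * of_int m * complex_of_real \<xi> / complex_of_real d))) *
     (\<Sum>j=1..N. complex_of_real (q j) *
        (complex_of_real (exp (decay_rate d \<beta> m * snd (s j))) *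
         exp (- 2 * complex_of_real pi * \<i> * of_int m * complex_of_real (fst (s j)) / complex_of_real d) /
         complex_of_real (decay_rate d \<beta> m)))"

end

theory Submission
  imports Defs "HOL-Probability.Characteristic_Functions"
begin

text \<open>The substitution \<open>u = v + ln (2\<beta>/r)\<close> turns the integral for \<open>K\<^sub>0\<close> into
  \<open>2 K\<^sub>0(\<beta>r) = \<integral> exp (-\<beta>\<^sup>2 e\<^sup>v - r\<^sup>2 e\<^bsup>-v\<^esup>/4) dv\<close>, a superposition of Gaussians in \<open>r\<close>. Poisson
  summation of these Gaussians along a row of sources, followed by the closed form
  \<open>\<integral> exp (v/2 - \<lambda>\<^sup>2 e\<^sup>v - Y\<^sup>2 e\<^bsup>-v\<^esup>/4) dv = \<surd>\<pi> e\<^bsup>-\<lambda>Y\<^esup>/\<lambda>\<close>, gives the plane-wave expansion of the row; it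
  converges absolutely because the row lies strictly below the target (\<open>Y > 0\<close>). The rows
  \<open>n \<le> -2\<close> then form a geometric series for each \<open>m\<close>.\<close>

section \<open>Interchange of sums over the integers and integrals\<close>

text \<open>In \<open>bessel_K0 (\<beta> * sqrt (X^2 + Y^2))\<close> the two coordinates are tied
  together by the square root. A Gaussian in the distance is instead a product of a factor in
  \<open>X\<close> and a factor in \<open>Y\<close>, so Poisson summation acts on \<open>X\<close>
  alone and the height is carried along as a constant. Two interchanges of sum and integral in
  \<open>v\<close> are then required, and they rest on different grounds. On the frequency side the
  terms oscillate, so the integrals of their norms must be summable; this is where
  \<open>Y > 0\<close> enters. On the source side the terms are nonnegative, so it suffices that
  their sum is integrable, and that is inherited from the frequency side. Hence no pointwise decay
  estimate for the Bessel function is required. The Poisson formula itself rests on uniqueness of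
  Fourier coefficients for continuous periodic functions, obtained from Stone-Weierstrass on the
  unit circle.\<close>

lemma
  fixes f :: "int \<Rightarrow> 'a \<Rightarrow> 'b :: {banach, second_countable_topology}"
  assumes int: "\<And>k. integrable M (f k)"
    and pw: "\<And>x. (\<lambda>k. norm (f k x)) summable_on UNIV"
    and sm: "(\<lambda>k. \<integral>x. norm (f k x) \<partial>M) summable_on UNIV"
  shows integrable_infsum_int: "integrable M (\<lambda>x. \<Sum>\<^sub>\<infinity>k. f k x)"
    and has_sum_integral_int: "((\<lambda>k. \<integral>x. f k x \<partial>M) has_sum (\<integral>x. (\<Sum>\<^sub>\<infinity>k. f k x) \<partial>M)) UNIV"
proof -
  \<comment> \<open>An enumeration of the integers reduces the claim to the theorems on series of
    integrable functions; absolute summability makes the result independent of the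
    enumeration.\<close>
  have bij: "bij_betw int_decode UNIV UNIV"
    by (rule bij_int_decode)
  have pw': "summable (\<lambda>i. norm (f (int_decode i) x))" for x
    using pw[of x] summable_on_reindex_bij_betw[OF bij, of "\<lambda>k. norm (f k x)"]
    by (simp add: summable_on_UNIV_nonneg_real_iff)
  have sm': "summable (\<lambda>i. \<integral>x. norm (f (int_decode i) x) \<partial>M)"
    using sm summable_on_reindex_bij_betw[OF bij, of "\<lambda>k. \<integral>x. norm (f k x) \<partial>M"]
    by (simp add: summable_on_UNIV_nonneg_real_iff)
  have eq: "(\<Sum>i. f (int_decode i) x) = (\<Sum>\<^sub>\<infinity>k. f k x)" for x
  proof -
    have "((\<lambda>i. f (int_decode i) x) has_sum (\<Sum>i. f (int_decode i) x)) UNIV"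
      using norm_summable_imp_has_sum[OF pw' summable_sums[OF summable_norm_cancel[OF pw']]] .
    then show ?thesis
      unfolding has_sum_reindex_bij_betw[OF bij, of "\<lambda>k. f k x"] by (simp add: infsumI)
  qed
  show "integrable M (\<lambda>x. \<Sum>\<^sub>\<infinity>k. f k x)"
    using integrable_suminf[OF int, of int_decode] pw' sm' unfolding eq by simp
  have "(\<lambda>i. \<integral>x. f (int_decode i) x \<partial>M) sums (\<integral>x. (\<Sum>\<^sub>\<infinity>k. f k x) \<partial>M)"
    using sums_integral[OF int, of int_decode] pw' sm' unfolding eq by simp
  moreover have "summable (\<lambda>i. norm (\<integral>x. f (int_decode i) x \<partial>M))"
    by (rule summable_comparison_test'[OF sm']) (simp add: integral_norm_bound)
  ultimately have "((\<lambda>i. \<integral>x. f (int_decode i) x \<partial>M) has_sum (\<integral>x. (\<Sum>\<^sub>\<infinity>k. f k x) \<partial>M)) UNIV"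
    by (intro norm_summable_imp_has_sum)
  then show "((\<lambda>k. \<integral>x. f k x \<partial>M) has_sum (\<integral>x. (\<Sum>\<^sub>\<infinity>k. f k x) \<partial>M)) UNIV"
    using has_sum_reindex_bij_betw[OF bij, of "\<lambda>k. \<integral>x. f k x \<partial>M"] by simp
qed

text \<open>Finite partial sums of nonnegative terms lie below \<open>g\<close>, so the partial sums
  of their integrals lie below the integral of \<open>g\<close>. Integrability of the total thus
  replaces any hypothesis on the individual integrals.\<close>

lemma
  fixes f :: "int \<Rightarrow> 'a \<Rightarrow> real"
  assumes meas: "\<And>k. f k \<in> borel_measurable M"
    and nonneg: "\<And>k x. 0 \<le> f k x"
    and sum: "\<And>x. ((\<lambda>k. f k x) has_sum g x) UNIV"
    and g: "integrable M g"
  shows integrable_nonneg_has_sum: "integrable M (f k)"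
    and has_sum_integral_nonneg: "((\<lambda>k. \<integral>x. f k x \<partial>M) has_sum (\<integral>x. g x \<partial>M)) UNIV"
proof -
  have fin: "(\<Sum>k\<in>F. f k x) \<le> g x" if "finite F" for F x
    using finite_sum_le_has_sum[OF sum that] nonneg by simp
  have int: "integrable M (f k)" for k
    by (rule Bochner_Integration.integrable_bound[OF g meas])
       (use fin[of "{k}"] nonneg[of k] in \<open>auto intro!: AE_I2 simp: abs_of_nonneg intro: order_trans[OF _ abs_ge_self]\<close>)
  then show "integrable M (f k)" .
  have "(\<lambda>k. \<integral>x. f k x \<partial>M) summable_on UNIV"
  proof (rule nonneg_bounded_partial_sums_imp_summable_on)
    show "\<forall>\<^sub>F F in finite_subsets_at_top UNIV. (\<Sum>k\<in>F. \<integral>x. f k x \<partial>M) \<le> (\<integral>x. g x \<partial>M)"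
    proof (rule eventually_finite_subsets_at_top_weakI)
      fix F :: "int set" assume F: "finite F"
      have "(\<Sum>k\<in>F. \<integral>x. f k x \<partial>M) = (\<integral>x. (\<Sum>k\<in>F. f k x) \<partial>M)"
        using int by simp
      also have "\<dots> \<le> (\<integral>x. g x \<partial>M)"
        using int g fin[OF F] by (intro integral_mono) auto
      finally show "(\<Sum>k\<in>F. \<integral>x. f k x \<partial>M) \<le> (\<integral>x. g x \<partial>M)" .
    qed
  qed (use nonneg in auto)
  moreover have "(\<lambda>k. norm (f k x)) summable_on UNIV" for x
    using sum[of x] nonneg by (auto simp: abs_of_nonneg has_sum_imp_summable)
  ultimately have "((\<lambda>k. \<integral>x. f k x \<partial>M) has_sum (\<integral>x. (\<Sum>\<^sub>\<infinity>k. f k x) \<partial>M)) UNIV"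
    using nonneg int by (intro has_sum_integral_int) (auto simp: abs_of_nonneg)
  then show "((\<lambda>k. \<integral>x. f k x \<partial>M) has_sum (\<integral>x. g x \<partial>M)) UNIV"
    using infsumI[OF sum] by simp
qed

section \<open>Uniqueness of Fourier coefficients\<close>

lemma continuous_on_circle_lift:
  fixes h :: "real \<Rightarrow> 'a :: real_normed_vector"
  assumes "continuous_on {0..1} h" and "h 0 = h 1"
  shows "continuous_on (sphere 0 1) (\<lambda>z. h (Arg2pi z / (2 * pi)))"
proof -
  \<comment> \<open>\<open>h\<close> is a loop, and the homotopy library transfers loops to maps on the circle.\<close>
  have "homotopic_loops (path_image h) h h"
    using assms by (simp add: homotopic_loops_refl path_def pathfinish_def pathstart_def)
  then show ?thesis
    using homotopic_loops_imp_homotopic_circlemaps homotopic_with_imp_continuous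
    by (fastforce simp: o_def)
qed

lemma continuous_on_real_polynomial_cis:
  fixes p :: "complex \<Rightarrow> real"
  assumes "real_polynomial_function p"
  shows "continuous_on A (\<lambda>x. p (cis (2 * pi * x)))"
proof -
  have "continuous_on UNIV p"
    using assms by (intro continuous_on_polymonial_function) (simp add: real_polynomial_function_eq)
  then show ?thesis
    by (rule continuous_on_compose2) (auto intro!: continuous_intros)
qed

text \<open>Orthogonality to all exponentials passes from \<open>h\<close> to \<open>h p\<close>; stated for all \<open>h\<close> and \<open>k\<close>, this is
  preserved by products of polynomials.\<close>

lemma orthogonal_real_polynomial:
  fixes p :: "complex \<Rightarrow> real" and h :: "real \<Rightarrow> complex"
  assumes "real_polynomial_function p" and "continuous_on {0..1} h"
    and "\<And>k::int. integral {0..1} (\<lambda>x. h x * cis (2 * pi * of_int k * x)) = 0"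
  shows "integral {0..1} (\<lambda>x. h x * of_real (p (cis (2 * pi * x))) * cis (2 * pi * of_int k * x)) = 0"
  using assms
proof (induction arbitrary: h k rule: real_polynomial_function.induct)
  case (linear f)
  \<comment> \<open>\<open>f\<close> is only real-linear, so on the circle it equals
    \<open>f 1 * cos t + f \<i> * sin t\<close>; \<open>c\<close> is the coefficient of
    \<open>cis t\<close> in that expression. Multiplying by \<open>f\<close> therefore only shifts
    the frequency \<open>k\<close> by one in either direction, and both shifted integrals
    vanish.\<close>
  define c where "c = Complex (f 1 / 2) (- f \<i> / 2)"
  have f: "of_real (f (cis t)) = c * cis t + cnj c * cis (- t)" for t
  proof -
    have "f (cis t) = f (cos t *\<^sub>R 1 + sin t *\<^sub>R \<i>)"
      by (rule arg_cong[of _ _ f]) (simp add: complex_eq_iff)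
    also have "\<dots> = cos t * f 1 + sin t * f \<i>"
      by (simp add: linear.hyps bounded_linear.linear linear_add linear_scale)
    finally show ?thesis
      by (simp add: complex_eq_iff c_def)
  qed
  have up: "cis (2 * pi * of_int (k + 1) * x) = cis (2 * pi * x) * cis (2 * pi * of_int k * x)"
    and down: "cis (2 * pi * of_int (k - 1) * x) = cis (- (2 * pi * x)) * cis (2 * pi * of_int k * x)" for x
    by (simp_all add: cis_mult algebra_simps)
  have "h x * of_real (f (cis (2 * pi * x))) * cis (2 * pi * of_int k * x)
      = c * (h x * cis (2 * pi * of_int (k + 1) * x)) + cnj c * (h x * cis (2 * pi * of_int (k - 1) * x))" for x
    unfolding f up down by (simp only: distrib_left distrib_right mult_ac)
  moreover have "(\<lambda>x. h x * cis (2 * pi * of_int j * x)) integrable_on {0..1}" for j :: int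
    by (intro integrable_continuous_real continuous_intros linear.prems)
  ultimately show ?case
    by (simp only: integral_add integrable_on_mult_right integral_mult_right linear.prems(2) mult_zero_right add_0_left)
next
  case (const c)
  have "integral {0..1} (\<lambda>x. of_real c * (h x * cis (2 * pi * of_int k * x))) = 0"
    by (simp only: integral_mult_right const.prems(2) mult_zero_right)
  then show ?case
    by (simp only: mult_ac)
next
  case (add f g)
  have "(\<lambda>x. h x * of_real (p (cis (2 * pi * x))) * cis (2 * pi * of_int k * x)) integrable_on {0..1}"
    if "real_polynomial_function p" for p :: "complex \<Rightarrow> real"
    by (intro integrable_continuous_real continuous_intros add.prems(1) continuous_on_real_polynomial_cis[OF that])
  note int = this
  have "integral {0..1} (\<lambda>x. h x * of_real (f (cis (2 * pi * x)) + g (cis (2 * pi * x))) * cis (2 * pi * of_int k * x))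
    = integral {0..1} (\<lambda>x. h x * of_real (f (cis (2 * pi * x))) * cis (2 * pi * of_int k * x)
        + h x * of_real (g (cis (2 * pi * x))) * cis (2 * pi * of_int k * x))"
    by (simp only: of_real_add distrib_left distrib_right)
  also have "\<dots> = 0"
    by (simp only: integral_add[OF int[OF add.hyps(1)] int[OF add.hyps(2)]] add.IH[OF add.prems] add_0_left)
  finally show ?case .
next
  case (mult f g)
  have "continuous_on {0..1} (\<lambda>x. h x * of_real (f (cis (2 * pi * x))))"
    by (intro continuous_intros mult.prems(1) continuous_on_real_polynomial_cis[OF mult.hyps(1)])
  from mult.IH(2)[OF this mult.IH(1)[OF mult.prems]] show ?case
    by (simp only: of_real_mult mult.assoc)
qed

text \<open>Being orthogonal to all polynomials in \<open>cis (2 * pi * x)\<close>, \<open>h\<close>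
  can be tested against \<open>cnj h - g\<close> in place of \<open>cnj h\<close>, where
  \<open>g\<close> is a polynomial uniformly close to \<open>cnj h\<close>. The integral of
  \<open>norm (h x)^2\<close> is then at most an arbitrarily small multiple of the integral of
  \<open>norm (h x)\<close>, and continuity turns the vanishing integral into vanishing at each
  point.\<close>

theorem fourier_uniqueness:
  fixes h :: "real \<Rightarrow> complex"
  assumes cont: "continuous_on {0..1} h" and per: "h 0 = h 1"
    and coeff: "\<And>k::int. integral {0..1} (\<lambda>x. h x * cis (2 * pi * of_int k * x)) = 0"
    and x: "x \<in> {0..1}"
  shows "h x = 0"
proof -
  define J where "J = integral {0..1} (\<lambda>x. norm (h x))"
  have J: "0 \<le> J"
    unfolding J_def by (intro integral_nonneg integrable_continuous_real continuous_intros cont) auto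
  have poly: "integral {0..1} (\<lambda>x. h x * g (cis (2 * pi * x))) = 0" if g: "polynomial_function g" for g :: "complex \<Rightarrow> complex"
  proof -
    have re: "real_polynomial_function (\<lambda>z. Re (g z))" and im: "real_polynomial_function (\<lambda>z. Im (g z))"
      using g bounded_linear_Re bounded_linear_Im by (auto simp: polynomial_function_def o_def)
    have int: "(\<lambda>x. h x * of_real (p (cis (2 * pi * x)))) integrable_on {0..1}"
      if "real_polynomial_function p" for p :: "complex \<Rightarrow> real"
      by (intro integrable_continuous_real continuous_intros cont continuous_on_real_polynomial_cis[OF that])
    have "h x * g (cis (2 * pi * x)) = h x * of_real (Re (g (cis (2 * pi * x))))
        + \<i> * (h x * of_real (Im (g (cis (2 * pi * x)))))" for x
      by (simp add: complex_eq_iff)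
    moreover have "integral {0..1} (\<lambda>x. h x * of_real (Re (g (cis (2 * pi * x))))) = 0"
      using orthogonal_real_polynomial[OF re cont coeff, of 0] by simp
    moreover have "integral {0..1} (\<lambda>x. h x * of_real (Im (g (cis (2 * pi * x))))) = 0"
      using orthogonal_real_polynomial[OF im cont coeff, of 0] by simp
    ultimately show ?thesis
      by (simp only: integral_add[OF int[OF re] integrable_on_mult_right[OF int[OF im]]]
          integral_mult_right mult_zero_right add_0_left)
  qed
  have small: "norm (integral {0..1} (\<lambda>x. h x * cnj (h x))) \<le> e * J" if e: "e > 0" for e
  proof -
    have "continuous_on (sphere 0 1) (\<lambda>z. cnj (h (Arg2pi z / (2 * pi))))"
      by (intro continuous_intros continuous_on_circle_lift cont per)
    then obtain g where g: "polynomial_function g"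
      and close: "\<And>z. z \<in> sphere 0 1 \<Longrightarrow> norm (cnj (h (Arg2pi z / (2 * pi))) - g z) < e"
      using Stone_Weierstrass_polynomial_function[of "sphere 0 1" _ e] e by (metis compact_sphere)
    have bound: "norm (cnj (h x) - g (cis (2 * pi * x))) \<le> e" if x: "x \<in> {0..1}" for x
    proof -
      have "h (Arg2pi (cis (2 * pi * x)) / (2 * pi)) = h x"
      \<comment> \<open>\<open>Arg2pi\<close> takes values below \<open>2 * pi\<close>, so the
        endpoint 1 is sent to 0; there the hypothesis \<open>h 0 = h 1\<close> is what closes the
        gap.\<close>
      proof (cases "x = 1")
        case True
        then show ?thesis using per Arg2pi_of_real[of 1] by simp
      next
        case False
        have "Arg2pi (cis (2 * pi * x)) = 2 * pi * x"
          using x False by (intro Arg2pi_unique[of 1]) (auto simp: cis_conv_exp)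
        then show ?thesis by simp
      qed
      then show ?thesis
        using close[of "cis (2 * pi * x)"] by (simp add: less_imp_le)
    qed
    have gcont: "continuous_on {0..1} (\<lambda>x. g (cis (2 * pi * x)))"
      by (rule continuous_on_compose2[OF continuous_on_polymonial_function[OF g, of UNIV]])
        (auto intro!: continuous_on_cis continuous_intros)
    have "integral {0..1} (\<lambda>x. h x * cnj (h x))
        = integral {0..1} (\<lambda>x. h x * (cnj (h x) - g (cis (2 * pi * x))))"
      unfolding right_diff_distrib
      by (subst integral_diff) (auto intro!: integrable_continuous_real continuous_on_mult continuous_on_cnj continuous_on_diff cont gcont simp: poly[OF g])
    also have "norm \<dots> \<le> integral {0..1} (\<lambda>x. e * norm (h x))"
    proof (rule integral_norm_bound_integral)
      show "norm (h x * (cnj (h x) - g (cis (2 * pi * x)))) \<le> e * norm (h x)" if "x \<in> {0..1}" for x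
        using mult_left_mono[OF bound[OF that], of "norm (h x)"] by (simp add: norm_mult mult.commute)
    qed (auto intro!: integrable_continuous_real continuous_on_mult continuous_on_const continuous_on_norm continuous_on_cnj continuous_on_diff cont gcont)
    finally show ?thesis
      by (simp add: J_def)
  qed
  have "norm (integral {0..1} (\<lambda>x. h x * cnj (h x))) \<le> 0"
  proof (rule field_le_epsilon)
    fix e :: real assume e: "e > 0"
    \<comment> \<open>The summand 1 keeps the divisor positive when \<open>J = 0\<close>.\<close>
    have "e / (J + 1) * J \<le> e"
      using J e by (simp add: field_simps)
    then show "norm (integral {0..1} (\<lambda>x. h x * cnj (h x))) \<le> 0 + e"
      using small[of "e / (J + 1)"] J e by simp
  qed
  moreover have "((\<lambda>x. h x * cnj (h x)) has_integral of_real (integral {0..1} (\<lambda>x. (norm (h x))\<^sup>2))) {0..1}"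
    unfolding complex_norm_square[symmetric]
    by (intro has_integral_of_real integrable_integral integrable_continuous_real
        continuous_on_power continuous_on_norm cont)
  then have "integral {0..1} (\<lambda>x. h x * cnj (h x)) = of_real (integral {0..1} (\<lambda>x. (norm (h x))\<^sup>2))"
    by (rule integral_unique)
  ultimately have "integral {0..1} (\<lambda>x. (norm (h x))\<^sup>2) = 0"
    by simp
  then have "(norm (h x))\<^sup>2 = 0"
    by (subst (asm) integral_eq_0_iff) (use x in \<open>auto intro!: continuous_intros cont\<close>)
  then show ?thesis by simp
qed

lemma has_integral_cis_int:
  "((\<lambda>x. cis (2 * pi * of_int k * x)) has_integral (if k = 0 then 1 else 0)) {0..1}"
proof (cases "k = 0")
  case True
  then show ?thesis
    using has_integral_const_real[of "1::complex" 0 1] by simp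
next
  case False
  have "((\<lambda>x. cis (2 * pi * of_int k * x)) has_integral
      cis (2 * pi * of_int k * 1) / (2 * pi * \<i> * of_int k) - cis (2 * pi * of_int k * 0) / (2 * pi * \<i> * of_int k)) {0..1}"
  proof (rule fundamental_theorem_of_calculus)
    show "((\<lambda>x. cis (2 * pi * of_int k * x) / (2 * pi * \<i> * of_int k)) has_vector_derivative
        cis (2 * pi * of_int k * x)) (at x within {0..1})" for x
      unfolding cis_conv_exp has_real_derivative_iff_has_vector_derivative
      by (rule has_vector_derivative_real_field | rule derivative_eq_intros refl | use False in \<open>simp add: field_simps\<close>)+
  qed simp
  moreover have "cis (2 * pi * of_int k) = 1"
    using cis_multiple_2pi[of "of_int k"] by simp
  ultimately show ?thesis
    using False by simp
qed

text \<open>The series converges uniformly, so its sum is continuous and may be integrated term by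
  term, which recovers the coefficients \<open>c\<close>. The difference from \<open>F\<close> has
  only zero coefficients, and uniqueness applies to it.\<close>

lemma fourier_series_eq:
  fixes F :: "real \<Rightarrow> complex" and c :: "int \<Rightarrow> complex"
  assumes cont: "continuous_on {0..1} F" and per: "F 0 = F 1"
    and c: "(\<lambda>k. norm (c k)) summable_on UNIV"
    and coeff: "\<And>k. integral {0..1} (\<lambda>x. F x * cis (- (2 * pi * of_int k * x))) = c k"
    and x: "x \<in> {0..1}"
  shows "F x = (\<Sum>\<^sub>\<infinity>k. c k * cis (2 * pi * of_int k * x))"
proof -
  define C where "C x = (\<Sum>\<^sub>\<infinity>k. c k * cis (2 * pi * of_int k * x))" for x :: real
  have unif: "uniform_limit {0..1} (\<lambda>K x. \<Sum>k\<in>K. c k * cis (2 * pi * of_int k * x)) C (finite_subsets_at_top UNIV)"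
    unfolding C_def by (rule Weierstrass_m_test_general[OF _ c]) (simp add: norm_mult)
  have contC: "continuous_on {0..1} C"
    by (rule uniform_limit_theorem[OF _ unif]) (auto intro!: always_eventually continuous_intros)
  \<comment> \<open>The uniqueness theorem tests against exponentials with a positive sign, whereas
    coefficients are defined with a negative one; hence the index \<open>- j\<close>.\<close>
  have "integral {0..1} (\<lambda>x. C x * cis (2 * pi * of_int j * x)) = c (- j)" for j :: int
  proof -
    have "uniform_limit {0..1} (\<lambda>K x. (\<Sum>k\<in>K. c k * cis (2 * pi * of_int k * x)) * cis (2 * pi * of_int j * x))
        (\<lambda>x. C x * cis (2 * pi * of_int j * x)) (finite_subsets_at_top UNIV)"
      by (intro uniform_lim_mult unif uniform_limit_const compact_imp_bounded compact_continuous_image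
          contC continuous_intros compact_Icc)
    then obtain I J where I: "\<And>K. ((\<lambda>x. (\<Sum>k\<in>K. c k * cis (2 * pi * of_int k * x)) * cis (2 * pi * of_int j * x)) has_integral I K) {0..1}"
      and J: "((\<lambda>x. C x * cis (2 * pi * of_int j * x)) has_integral J) {0..1}"
      and lim: "(I \<longlongrightarrow> J) (finite_subsets_at_top UNIV)"
      by (rule uniform_limit_integral) (auto intro!: always_eventually continuous_intros)
    have "I = sum (\<lambda>k. c k * (if k = - j then 1 else 0))"
    proof (rule ext, rule has_integral_unique[OF I])
      fix K
      have "((\<lambda>x. \<Sum>k\<in>K. c k * cis (2 * pi * of_int (k + j) * x)) has_integral
          (\<Sum>k\<in>K. c k * (if k + j = 0 then 1 else 0))) {0..1}" if "finite K"
        by (intro has_integral_sum that has_integral_mult_right has_integral_cis_int)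
      then show "((\<lambda>x. (\<Sum>k\<in>K. c k * cis (2 * pi * of_int k * x)) * cis (2 * pi * of_int j * x)) has_integral
          (\<Sum>k\<in>K. c k * (if k = - j then 1 else 0))) {0..1}"
        by (cases "finite K") (simp_all add: sum_distrib_right mult.assoc cis_mult distrib_left distrib_right
            eq_neg_iff_add_eq_0)
    qed
    then have "((\<lambda>k. c k * (if k = - j then 1 else 0)) has_sum J) UNIV"
      using lim by (simp add: has_sum_def)
    moreover have "((\<lambda>k. c k * (if k = - j then 1 else 0)) has_sum c (- j)) UNIV"
      by (rule has_sum_finite_neutralI[of "{- j}"]) auto
    ultimately show ?thesis
      using J has_sum_unique integral_unique by metis
  qed
  then have "integral {0..1} (\<lambda>x. (F x - C x) * cis (2 * pi * of_int j * x)) = 0" for j :: int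
    using coeff[of "- j"] unfolding left_diff_distrib
    by (subst integral_diff) (auto intro!: integrable_continuous_real continuous_intros cont contC)
  moreover have "cis (2 * pi * of_int k) = 1" for k :: int
    using cis_multiple_2pi[of "of_int k"] by simp
  then have "C 0 = C 1"
    by (simp add: C_def)
  ultimately have "F x - C x = 0"
    by (intro fourier_uniqueness[where h = "\<lambda>x. F x - C x"] continuous_intros cont contC x) (simp_all add: per)
  then show ?thesis
    by (simp add: C_def)
qed

section \<open>Poisson summation\<close>

text \<open>This is unfolding: translating \<open>f m\<close> by \<open>m\<close> gives
  \<open>g m\<close>, which is \<open>G\<close> cut off to the interval from \<open>- m\<close> to
  \<open>1 - m\<close>. Half-open intervals are used so that these pieces tile the line, with
  exactly one nonzero cutoff factor at each \<open>x\<close>, at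
  \<open>m = - \<lfloor>x\<rfloor>\<close>. The norms of the pieces therefore add up to
  \<open>norm (G x)\<close>, which justifies the interchange.\<close>

lemma integral_periodization:
  fixes G :: "real \<Rightarrow> complex"
  assumes G: "integrable lborel G"
    and sm: "\<And>x. x \<in> {0..<1} \<Longrightarrow> (\<lambda>m::int. norm (G (x - of_int m))) summable_on UNIV"
  shows "(\<integral>x. indicator {0..<1} x *\<^sub>R (\<Sum>\<^sub>\<infinity>m::int. G (x - of_int m)) \<partial>lborel) = (\<integral>x. G x \<partial>lborel)" (is ?eq)
proof -
  define f where "f m x = indicator {0..<1} x *\<^sub>R G (x - of_int m)" for m :: int and x :: real
  define g where "g m x = indicator {0..<1} (x + of_int m) *\<^sub>R G x" for m :: int and x :: real
  have [measurable]: "G \<in> borel_measurable lborel"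
    using G by (rule borel_measurable_integrable)
  have fg: "f m x = g m (- of_int m + 1 * x)" for m x
    by (simp add: f_def g_def)
  have int_g: "integrable lborel (g m)" for m
    unfolding g_def by (rule Bochner_Integration.integrable_bound[OF G]) (auto simp: indicator_def)
  have int_f: "integrable lborel (f m)" for m
    using lborel_integrable_real_affine[OF int_g, of 1 m "- of_int m"] unfolding fg[symmetric] by simp
  have eq: "(\<integral>x. f m x \<partial>lborel) = (\<integral>x. g m x \<partial>lborel)"
    and eqn: "(\<integral>x. norm (f m x) \<partial>lborel) = (\<integral>x. norm (g m x) \<partial>lborel)" for m
    using lborel_integral_real_affine[of 1 "g m" "- of_int m"]
      lborel_integral_real_affine[of 1 "\<lambda>x. norm (g m x)" "- of_int m"] by (simp_all add: fg)
  have one: "((\<lambda>m. indicator {0..<1} (x + of_int m :: real) *\<^sub>R z) has_sum z) UNIV" for x and z :: "'b :: real_normed_vector"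
  proof (rule has_sum_finite_neutralI[of "{- \<lfloor>x\<rfloor>}"])
    show "indicator {0..<1} (x + of_int m) *\<^sub>R z = 0" if "m \<in> UNIV - {- \<lfloor>x\<rfloor>}" for m
    proof -
      have "\<not> (0 \<le> x + of_int m \<and> x + of_int m < 1)"
        using that floor_unique[of "- m" x] by auto
      then show ?thesis by simp
    qed
    show "z = (\<Sum>m\<in>{- \<lfloor>x\<rfloor>}. indicator {0..<1} (x + of_int m) *\<^sub>R z)"
      using floor_correct[of x] by (simp add: indicator_def) linarith
  qed auto
  have sg: "((\<lambda>m. g m x) has_sum G x) UNIV" and ng: "((\<lambda>m. norm (g m x)) has_sum norm (G x)) UNIV" for x
    unfolding g_def using one[of x "G x"] one[of x "norm (G x)"] by simp_all
  have sm_g: "(\<lambda>m. \<integral>x. norm (g m x) \<partial>lborel) summable_on UNIV"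
    using has_sum_integral_nonneg[OF _ _ ng integrable_norm[OF G]] borel_measurable_integrable[OF int_g]
    by (auto simp: has_sum_imp_summable)
  have 1: "((\<lambda>m. \<integral>x. g m x \<partial>lborel) has_sum (\<integral>x. G x \<partial>lborel)) UNIV"
    using has_sum_integral_int[OF int_g has_sum_imp_summable[OF ng] sm_g] by (simp add: infsumI[OF sg])
  have "(\<lambda>m. norm (f m x)) summable_on UNIV" for x
    using sm by (cases "x \<in> {0..<1}") (auto simp: f_def)
  then have "((\<lambda>m. \<integral>x. f m x \<partial>lborel) has_sum (\<integral>x. (\<Sum>\<^sub>\<infinity>m. f m x) \<partial>lborel)) UNIV"
    using int_f sm_g by (intro has_sum_integral_int) (simp_all add: eqn)
  then have "(\<integral>x. (\<Sum>\<^sub>\<infinity>m. f m x) \<partial>lborel) = (\<integral>x. G x \<partial>lborel)"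
    using 1 unfolding eq by (rule has_sum_unique)
  moreover have "(\<Sum>\<^sub>\<infinity>m. f m x) = indicator {0..<1} x *\<^sub>R (\<Sum>\<^sub>\<infinity>m::int. G (x - of_int m))" for x
    by (simp add: f_def indicator_def)
  ultimately show ?eq by simp
qed

text \<open>\<open>M\<close> majorises the translates over the unit interval, which makes the
  periodization \<open>F\<close> continuous there. Unfolding identifies its Fourier coefficients
  with integrals over the line, and periodicity carries the expansion from \<open>frac x\<close> to
  every \<open>x\<close>.\<close>

theorem poisson_summation:
  fixes G :: "real \<Rightarrow> complex" and M :: "int \<Rightarrow> real"
  assumes cont: "continuous_on UNIV G" and int: "integrable lborel G"
    and M: "M summable_on UNIV"
    and bound: "\<And>m x. x \<in> {0..1} \<Longrightarrow> norm (G (x - of_int m)) \<le> M m"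
    and coeff: "\<And>k::int. (\<integral>x. G x * cis (- (2 * pi * of_int k * x)) \<partial>lborel) = c k"
    and c: "(\<lambda>k. norm (c k)) summable_on UNIV"
  shows "((\<lambda>m::int. G (x - of_int m)) has_sum (\<Sum>\<^sub>\<infinity>k::int. c k * cis (2 * pi * of_int k * x))) UNIV"
proof -
  define F where "F x = (\<Sum>\<^sub>\<infinity>m::int. G (x - of_int m))" for x
  have cis1: "cis (2 * pi * of_int k * of_int m) = 1" for k m :: int
    using cis_multiple_2pi[of "of_int (k * m)"] by (simp add: mult.assoc)
  have sm: "(\<lambda>m::int. norm (G (x - of_int m))) summable_on UNIV" if "x \<in> {0..1}" for x
    using M by (rule summable_on_comparison_test) (use bound that in auto)
  have shift: "bij_betw (\<lambda>m::int. m - j) UNIV UNIV" for j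
    by (rule bij_betwI[of _ _ _ "\<lambda>m. m + j"]) auto
  have per: "F (x + of_int j) = F x" for x j
    using infsum_reindex_bij_betw[OF shift, of "\<lambda>m. G (x - of_int m)" j] by (simp add: F_def algebra_simps)
  have unif: "uniform_limit {0..1} (\<lambda>K x. \<Sum>m\<in>K. G (x - of_int m)) F (finite_subsets_at_top UNIV)"
    unfolding F_def by (rule Weierstrass_m_test_general[OF _ M]) (use bound in auto)
  have contF: "continuous_on {0..1} F"
    by (rule uniform_limit_theorem[OF _ unif])
       (auto intro!: always_eventually continuous_on_sum continuous_on_compose2[OF cont] continuous_intros)
  have "integral {0..1} (\<lambda>x. F x * cis (- (2 * pi * of_int k * x))) = c k" for k :: int
  proof -
    \<comment> \<open>The exponential is invariant under integer translations, so periodizing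
      \<open>H\<close> gives \<open>F\<close> times the same exponential, and the unfolding lemma
      applied to \<open>H\<close> yields the \<open>k\<close>-th coefficient.\<close>
    define H where "H x = G x * cis (- (2 * pi * of_int k * x))" for x
    have shiftH: "H (x - of_int m) = G (x - of_int m) * cis (- (2 * pi * of_int k * x))" for x and m :: int
    proof -
      have "cis (- (2 * pi * of_int k * (x - of_int m))) = cis (- (2 * pi * of_int k * x)) * cis (2 * pi * of_int k * of_int m)"
        by (simp add: cis_mult algebra_simps)
      then show ?thesis by (simp add: H_def cis1)
    qed
    have "integrable lborel H"
      unfolding H_def using int
      by (rule Bochner_Integration.integrable_bound)
         (auto simp: norm_mult intro!: borel_measurable_continuous_onI continuous_intros cont)
    then have "(\<integral>x. indicator {0..<1} x *\<^sub>R (\<Sum>\<^sub>\<infinity>m::int. H (x - of_int m)) \<partial>lborel) = c k"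
      using integral_periodization[of H] sm coeff[of k, folded H_def] by (simp add: shiftH norm_mult)
    then have "(\<integral>x. indicator {0..<1} x *\<^sub>R (F x * cis (- (2 * pi * of_int k * x))) \<partial>lborel) = c k"
      by (simp add: shiftH F_def infsum_cmult_left')
    moreover have "(\<integral>x. indicator {0..<1} x *\<^sub>R (F x * cis (- (2 * pi * of_int k * x))) \<partial>lborel)
        = (LINT x:{0..1}|lborel. F x * cis (- (2 * pi * of_int k * x)))"
      unfolding set_lebesgue_integral_def
      \<comment> \<open>The tiling needs the half-open interval and the Fourier results the closed
        one; they differ in a single point.\<close>
      by (rule integral_discrete_difference[of "{1}"]) (auto simp: indicator_def)
    moreover have "\<dots> = integral {0..1} (\<lambda>x. F x * cis (- (2 * pi * of_int k * x)))"
      unfolding set_integrable_def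
      by (intro set_borel_integral_eq_integral[unfolded set_integrable_def] borel_integrable_compact
          compact_Icc continuous_intros contF)
    ultimately show ?thesis by simp
  qed
  then have series: "F x = (\<Sum>\<^sub>\<infinity>k. c k * cis (2 * pi * of_int k * x))" if "x \<in> {0..1}" for x
    using that per[of 0 1] by (intro fourier_series_eq contF c) auto
  have x: "x = frac x + of_int \<lfloor>x\<rfloor>" "frac x \<in> {0..1}"
    by (auto simp: frac_def) linarith
  have "cis (2 * pi * of_int k * x) = cis (2 * pi * of_int k * frac x)" for k :: int
    by (subst x(1)) (simp add: distrib_left cis1 flip: cis_mult)
  then have "F x = (\<Sum>\<^sub>\<infinity>k. c k * cis (2 * pi * of_int k * x))"
    using series[OF x(2)] per[of "frac x" "\<lfloor>x\<rfloor>"] x(1) by simp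
  moreover have "(\<lambda>m::int. G (x - of_int m)) summable_on UNIV"
  proof -
    have "(\<lambda>m::int. G (frac x - of_int m)) summable_on UNIV"
      by (rule abs_summable_summable[OF sm[OF x(2)]])
    then have "(\<lambda>m::int. G (frac x - of_int (m - \<lfloor>x\<rfloor>))) summable_on UNIV"
      using summable_on_reindex_bij_betw[OF shift, of "\<lambda>m. G (frac x - of_int m)" "\<lfloor>x\<rfloor>"] by simp
    then show ?thesis
      by (simp add: frac_def)
  qed
  ultimately show ?thesis
    unfolding F_def by (simp add: has_sum_iff)
qed

section \<open>Gaussian sums over the integers and their Poisson formula\<close>

lemma summable_on_exp_neg_abs:
  assumes "c > 0"
  shows "(\<lambda>m::int. exp (- c * \<bar>of_int m\<bar>) :: real) summable_on UNIV"
proof -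
  have "summable (\<lambda>n. exp (- c) ^ n)"
    using assms by (intro summable_geometric) simp
  then have nat: "(\<lambda>n::nat. exp (- c * of_nat n)) summable_on UNIV"
    by (intro summable_nonneg_imp_summable_on) (simp_all add: mult.commute flip: exp_of_nat_mult)
  have "(\<lambda>m::int. exp (- c * \<bar>of_int m\<bar>)) summable_on {0..}"
    using nat by (rule summable_on_reindex_bij_witness[where i = nat and j = int, THEN iffD1, rotated -1]) auto
  moreover have "(\<lambda>m::int. exp (- c * \<bar>of_int m\<bar>)) summable_on {..0}"
    using nat by (rule summable_on_reindex_bij_witness[where i = "\<lambda>m. nat (- m)" and j = "\<lambda>n. - int n", THEN iffD1, rotated -1]) auto
  moreover have "UNIV = {0..} \<union> {..0::int}"
    by auto
  ultimately show ?thesis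
    by (metis summable_on_union)
qed

lemma summable_on_gaussian_int:
  assumes "a > 0"
  shows "(\<lambda>m::int. exp (- a * (of_int m)\<^sup>2) :: real) summable_on UNIV"
proof (rule summable_on_comparison_test[OF summable_on_exp_neg_abs[OF assms]])
  show "exp (- a * (of_int m)\<^sup>2) \<le> exp (- a * \<bar>of_int m :: real\<bar>)" for m :: int
  proof -
    have "\<bar>m\<bar> \<le> m\<^sup>2"
      using mult_left_mono[of 1 "\<bar>m\<bar>" "\<bar>m\<bar>"] by (cases "m = 0") (auto simp: power2_eq_square)
    then have "\<bar>of_int m :: real\<bar> \<le> (of_int m)\<^sup>2"
      by (metis of_int_abs of_int_le_iff of_int_power)
    then show ?thesis
      using assms by simp
  qed
qed auto

text \<open>The characteristic function of the standard normal distribution is already a Gaussian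
  Fourier transform. Rescaling by \<open>c = sqrt (2 * a)\<close> turns the exponent
  \<open>x^2 / 2\<close> into \<open>a * x^2\<close>, and the frequency \<open>t = w / c\<close>
  becomes \<open>w\<close>.\<close>

lemma has_bochner_integral_gaussian_cis:
  assumes a: "a > 0"
  shows "has_bochner_integral lborel (\<lambda>x. of_real (exp (- a * x\<^sup>2)) * cis (w * x))
    (of_real (sqrt (pi / a) * exp (- w\<^sup>2 / (4 * a))))"
proof -
  define c where "c = sqrt (2 * a)"
  define t where "t = w / c"
  have c: "c > 0" "c\<^sup>2 = 2 * a"
    using a by (simp_all add: c_def)
  let ?f = "\<lambda>x. of_real (std_normal_density x) * cis (t * x)"
  have int: "integrable lborel ?f"
    by (rule Bochner_Integration.integrable_bound[OF integrable_normal_density[of 1 0]])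
       (auto simp: norm_mult intro!: borel_measurable_times borel_measurable_continuous_onI[of "\<lambda>x. cis (t * x)"] continuous_intros)
  have "(\<integral>x. ?f x \<partial>lborel) = char std_normal_distribution t"
    unfolding char_def by (subst integral_density) (auto simp: scaleR_conv_of_real cis_conv_exp mult_ac)
  then have "has_bochner_integral lborel ?f (of_real (exp (- t\<^sup>2 / 2)))"
    using int by (simp add: has_bochner_integral_iff char_std_normal_distribution)
  then have "has_bochner_integral lborel (\<lambda>x. ?f (0 + c * x)) (of_real (exp (- t\<^sup>2 / 2)) /\<^sub>R \<bar>c\<bar>)"
    using c lborel_has_bochner_integral_real_affine_iff[of c ?f _ 0] by blast
  then have "has_bochner_integral lborel (\<lambda>x. of_real (sqrt (2 * pi)) * ?f (0 + c * x))
      (of_real (sqrt (2 * pi)) * (of_real (exp (- t\<^sup>2 / 2)) /\<^sub>R \<bar>c\<bar>))"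
    by (rule has_bochner_integral_mult_right)
  moreover have "of_real (sqrt (2 * pi)) * ?f (0 + c * x) = of_real (exp (- a * x\<^sup>2)) * cis (w * x)" for x
    using c by (simp add: std_normal_density_def power_mult_distrib t_def flip: of_real_mult)
  moreover have "of_real (sqrt (2 * pi)) * (of_real (exp (- t\<^sup>2 / 2)) /\<^sub>R \<bar>c\<bar>)
      = (of_real (sqrt (pi / a) * exp (- w\<^sup>2 / (4 * a))) :: complex)"
  proof -
    have "sqrt (2 * pi) / c = sqrt (pi / a)"
      using a by (simp add: c_def flip: real_sqrt_divide)
    moreover have "t\<^sup>2 / 2 = w\<^sup>2 / (4 * a)"
      using c by (simp add: t_def power_divide)
    ultimately show ?thesis
      using c by (simp add: scaleR_conv_of_real field_simps flip: of_real_mult of_real_divide)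
  qed
  ultimately show ?thesis
    by (simp only:)
qed

theorem gaussian_poisson:
  fixes a x :: real
  assumes a: "a > 0"
  shows "((\<lambda>m::int. of_real (exp (- a * (x - of_int m)\<^sup>2))) has_sum
    (\<Sum>\<^sub>\<infinity>k::int. of_real (sqrt (pi / a) * exp (- (pi * of_int k)\<^sup>2 / a)) * cis (2 * pi * of_int k * x))) UNIV"
proof (rule poisson_summation[where G = "\<lambda>x. of_real (exp (- a * x\<^sup>2))"
      and M = "\<lambda>m. exp a * exp (- (a / 2) * (of_int m)\<^sup>2)"])
  show "integrable lborel (\<lambda>x. complex_of_real (exp (- a * x\<^sup>2)))"
    using has_bochner_integral_gaussian_cis[OF a, of 0] by (simp add: has_bochner_integral_iff)
  show "(\<lambda>m::int. exp a * exp (- (a / 2) * (of_int m)\<^sup>2)) summable_on UNIV"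
    using a by (intro summable_on_cmult_right summable_on_gaussian_int) simp
  show "norm (complex_of_real (exp (- a * (x - of_int m)\<^sup>2))) \<le> exp a * exp (- (a / 2) * (of_int m)\<^sup>2)"
    if "x \<in> {0..1}" for m :: int and x
  proof -
    \<comment> \<open>The difference of the two sides is the square of \<open>2 * x - m\<close>.
      With \<open>x^2\<close> at most 1 this yields the majorant: half of the Gaussian rate, at the
      price of the factor \<open>exp a\<close>.\<close>
    have "(of_int m)\<^sup>2 \<le> 2 * (x - of_int m)\<^sup>2 + 2 * x\<^sup>2"
      using sum_power2_ge_zero[of "2 * x - of_int m" 0] by (simp add: power2_eq_square algebra_simps)
    moreover have "x\<^sup>2 \<le> 1"
      using that by (simp add: power_le_one)
    ultimately have "a * (of_int m)\<^sup>2 \<le> a * (2 * (x - of_int m)\<^sup>2 + 2)"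
      using a by (intro mult_left_mono) auto
    then show ?thesis
      by (simp add: algebra_simps flip: exp_add)
  qed
  show "(\<integral>x. of_real (exp (- a * x\<^sup>2)) * cis (- (2 * pi * of_int k * x)) \<partial>lborel)
      = complex_of_real (sqrt (pi / a) * exp (- (pi * of_int k)\<^sup>2 / a))" for k :: int
    using has_bochner_integral_integral_eq[OF has_bochner_integral_gaussian_cis[OF a, of "- (2 * pi * of_int k)"]]
    by (simp add: power_mult_distrib)
  have "(\<lambda>k::int. sqrt (pi / a) * exp (- (pi\<^sup>2 / a) * (of_int k)\<^sup>2)) summable_on UNIV"
    using a by (intro summable_on_cmult_right summable_on_gaussian_int) simp
  then show "(\<lambda>k::int. norm (complex_of_real (sqrt (pi / a) * exp (- (pi * of_int k)\<^sup>2 / a)))) summable_on UNIV"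
    using a by (simp add: norm_mult power_mult_distrib)
qed (intro continuous_intros)

section \<open>Heat-kernel representation of the Bessel function\<close>

lemma cosh_eq_sinh_half: "cosh u = 1 + 2 * (sinh (u / 2))\<^sup>2" for u :: real
  using cosh_double[of "u / 2"] cosh_square_eq[of "u / 2"] by simp

lemma range_sinh_half: "range (\<lambda>u::real. sinh (u / 2)) = UNIV"
  by (rule surjI[of _ "\<lambda>y. 2 * arsinh y"]) simp

text \<open>The weight \<open>cosh (u / 2)\<close> is, up to a factor 2, the derivative of
  \<open>w = sinh (u / 2)\<close>, and \<open>cosh u = 1 + 2 * w^2\<close>, so the substitution
  leaves a plain Gaussian integral. The value is twice the modified Bessel function of order one
  half, the elementary relative of \<open>bessel_K0\<close>.\<close>

lemma has_bochner_integral_exp_cosh_half: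
  fixes z :: real
  assumes z: "z > 0"
  shows "has_bochner_integral lborel (\<lambda>u. exp (- z * cosh u) * cosh (u / 2)) (2 * exp (- z) * sqrt (pi / (2 * z)))"
proof -
  let ?f = "\<lambda>w. exp (- (2 * z) * w\<^sup>2)"
  let ?h = "\<lambda>u. \<bar>cosh (u / 2) / 2\<bar> * ?f (sinh (u / 2))"
  have "has_bochner_integral lborel (\<lambda>w. complex_of_real (?f w)) (of_real (sqrt (pi / (2 * z))))"
    using has_bochner_integral_gaussian_cis[of "2 * z" 0] z by simp
  then have f: "has_bochner_integral lborel ?f (sqrt (pi / (2 * z)))"
    by (simp add: has_bochner_integral_iff complex_of_real_integrable_eq)
  then have "?f absolutely_integrable_on UNIV" "integral UNIV ?f = sqrt (pi / (2 * z))"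
    using has_integral_integral_lborel[of ?f]
    by (simp_all add: has_bochner_integral_iff set_integrable_def integrable_completion integral_unique)
  moreover have "((\<lambda>u. sinh (u / 2)) has_field_derivative cosh (u / 2) / 2) (at u within UNIV)" for u :: real
    by (auto intro!: derivative_eq_intros)
  moreover have "inj (\<lambda>u::real. sinh (u / 2))"
    by (auto intro: injI)
  ultimately have h: "?h absolutely_integrable_on UNIV" "integral UNIV ?h = sqrt (pi / (2 * z))"
    using has_absolute_integral_change_of_variables_1'[of UNIV "\<lambda>u. sinh (u / 2)" "\<lambda>u. cosh (u / 2) / 2" ?f]
    by (auto simp: range_sinh_half)
  have meas: "?h \<in> borel_measurable borel"
    by (intro borel_measurable_continuous_onI) (auto intro!: continuous_intros)
  have int: "integrable lborel ?h"
    using h(1) meas by (simp add: set_integrable_def integrable_completion)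
  have "(\<integral>u. ?h u \<partial>lborel) = sqrt (pi / (2 * z))"
    using integral_unique[OF has_integral_integral_lborel[OF int]] unfolding h(2) by (rule sym)
  then have "has_bochner_integral lborel (\<lambda>u. 2 * exp (- z) * ?h u) (2 * exp (- z) * sqrt (pi / (2 * z)))"
    using int by (intro has_bochner_integral_mult_right) (simp add: has_bochner_integral_iff)
  moreover have "2 * exp (- z) * ?h u = exp (- z * cosh u) * cosh (u / 2)" for u
    by (subst cosh_eq_sinh_half[of u]) (simp add: abs_of_pos algebra_simps flip: exp_add)
  ultimately show ?thesis by (simp only:)
qed

lemma has_bochner_integral_exp_cosh:
  assumes z: "z > 0"
  shows "has_bochner_integral lborel (\<lambda>u. exp (- z * cosh u)) (2 * bessel_K0 z)"
proof -
  have "integrable lborel (\<lambda>u. exp (- z * cosh u) * cosh (u / 2))"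
    using has_bochner_integral_exp_cosh_half[OF z] by (simp add: has_bochner_integral_iff)
  \<comment> \<open>\<open>cosh (u / 2)\<close> is at least 1, so the elementary integrand of order
    one half dominates that of order zero.\<close>
  then have "integrable lborel (\<lambda>u. exp (- z * cosh u))"
    by (rule Bochner_Integration.integrable_bound)
       (auto simp: cosh_real_ge_1 intro!: borel_measurable_continuous_onI continuous_intros)
  then have "integrable lborel (\<lambda>u. indicator {0..} u *\<^sub>R exp (- z * cosh u))"
    by (rule integrable_mult_indicator[rotated]) simp
  then have "has_bochner_integral lborel (\<lambda>u. indicator {0..} u *\<^sub>R exp (- z * cosh u)) (bessel_K0 z)"
    by (simp add: has_bochner_integral_iff bessel_K0_def set_lebesgue_integral_def)
  from has_bochner_integral_even_function[OF this] show ?thesis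
    by simp
qed

text \<open>\<open>exp (u / 2)\<close> is \<open>cosh (u / 2)\<close> plus
  \<open>sinh (u / 2)\<close>, and the odd part integrates to 0 against the even function
  \<open>exp (- z * cosh u)\<close>.\<close>

lemma has_bochner_integral_exp_cosh_exp_half:
  fixes z :: real
  assumes z: "z > 0"
  shows "has_bochner_integral lborel (\<lambda>u. exp (- z * cosh u) * exp (u / 2)) (2 * exp (- z) * sqrt (pi / (2 * z)))"
proof -
  have c: "has_bochner_integral lborel (\<lambda>u. exp (- z * cosh u) * cosh (u / 2)) (2 * exp (- z) * sqrt (pi / (2 * z)))"
    by (rule has_bochner_integral_exp_cosh_half[OF z])
  have le: "\<bar>sinh t\<bar> \<le> cosh t" for t :: real
    by (rule power2_le_imp_le) (simp_all add: cosh_square_eq)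
  have "integrable lborel (\<lambda>u. exp (- z * cosh u) * sinh (u / 2))"
    by (rule Bochner_Integration.integrable_bound[OF has_bochner_integral_iff[THEN iffD1, OF c, THEN conjunct1]])
       (auto simp: abs_mult le intro!: borel_measurable_continuous_onI continuous_intros)
  then have "integrable lborel (\<lambda>u. indicator {0..} u *\<^sub>R (exp (- z * cosh u) * sinh (u / 2)))"
    by (rule integrable_mult_indicator[rotated]) simp
  then have "has_bochner_integral lborel (\<lambda>u. exp (- z * cosh u) * sinh (u / 2)) 0"
    by (intro has_bochner_integral_odd_function[OF has_bochner_integral_integrable]) auto
  from has_bochner_integral_add[OF c this] show ?thesis
    by (simp add: sinh_plus_cosh[symmetric] algebra_simps)
qed

text \<open>The shift \<open>ln (2 * b / r)\<close> is the one that separates the parameters: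
  \<open>b\<close> is left only with \<open>exp v\<close> and \<open>r\<close> only with
  \<open>exp (- v)\<close>, and both occur squared.\<close>

lemma exp_cosh_shift:
  fixes b r :: real
  assumes "b > 0" "r > 0"
  shows "exp (- (b * r) * cosh (ln (2 * b / r) + v)) = exp (- b\<^sup>2 * exp v - r\<^sup>2 / 4 * exp (- v))"
proof -
  have "b * r * cosh (ln (2 * b / r) + v) = b\<^sup>2 * exp v + r\<^sup>2 / 4 * exp (- v)"
    using assms by (simp add: cosh_def exp_add exp_minus exp_diff ln_div field_simps power2_eq_square)
  then show ?thesis
    by (simp add: algebra_simps)
qed

lemma has_bochner_integral_heat_bessel_K0:
  assumes "b > 0" "r > 0"
  shows "has_bochner_integral lborel (\<lambda>v. exp (- b\<^sup>2 * exp v - r\<^sup>2 / 4 * exp (- v))) (2 * bessel_K0 (b * r))"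
  using has_bochner_integral_exp_cosh[of "b * r"] assms
    lborel_has_bochner_integral_real_affine_iff[of 1 "\<lambda>u. exp (- (b * r) * cosh u)" _ "ln (2 * b / r)"]
  by (simp only: exp_cosh_shift) simp

text \<open>The same shift is applied to the integral of order one half, and the constant
  \<open>sqrt (2 * b / r)\<close> coming from the weight is divided out. The weight
  \<open>exp (v / 2)\<close> is the one that Poisson summation produces: a Gaussian whose rate is
  proportional to \<open>exp (- v)\<close> has a transform with a prefactor proportional to
  \<open>exp (v / 2)\<close>.\<close>

lemma has_bochner_integral_heat_exp_half:
  assumes b: "b > 0" and r: "r > 0"
  shows "has_bochner_integral lborel (\<lambda>v. exp (v / 2) * exp (- b\<^sup>2 * exp v - r\<^sup>2 / 4 * exp (- v)))
    (sqrt pi * exp (- b * r) / b)"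
proof -
  define t where "t = ln (2 * b / r)"
  have et: "exp (t / 2) = sqrt (2 * b / r)"
  proof -
    have "t / 2 = ln (sqrt (2 * b / r))"
      using b r by (simp add: t_def ln_sqrt)
    then show ?thesis
      using b r by (simp only:) (subst exp_ln, auto)
  qed
  have "has_bochner_integral lborel (\<lambda>v. exp (- (b * r) * cosh (t + 1 * v)) * exp ((t + 1 * v) / 2))
      ((2 * exp (- (b * r)) * sqrt (pi / (2 * (b * r)))) /\<^sub>R \<bar>1\<bar>)"
    using has_bochner_integral_exp_cosh_exp_half[of "b * r"] b r
      lborel_has_bochner_integral_real_affine_iff[of 1 "\<lambda>u. exp (- (b * r) * cosh u) * exp (u / 2)" _ t] by simp
  then have "has_bochner_integral lborel
      (\<lambda>v. (exp (- (b * r) * cosh (t + v)) * exp ((t + v) / 2)) / sqrt (2 * b / r))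
      ((2 * exp (- (b * r)) * sqrt (pi / (2 * (b * r)))) / sqrt (2 * b / r))"
    by (intro has_bochner_integral_divide_zero) simp
  moreover have "(exp (- (b * r) * cosh (t + v)) * exp ((t + v) / 2)) / sqrt (2 * b / r)
      = exp (v / 2) * exp (- b\<^sup>2 * exp v - r\<^sup>2 / 4 * exp (- v))" for v
    using b r unfolding add_divide_distrib exp_add[of "t / 2"] et
    by (simp only: t_def exp_cosh_shift) simp
  moreover have "(2 * exp (- (b * r)) * sqrt (pi / (2 * (b * r)))) / sqrt (2 * b / r) = sqrt pi * exp (- b * r) / b"
    using b r by (simp add: real_sqrt_divide real_sqrt_mult field_simps)
  ultimately show ?thesis by simp
qed

section \<open>Decay rates and the plane-wave expansion of one row\<close>

lemma decay_rate_ge: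
  shows "\<beta> \<le> decay_rate d \<beta> k" and "d > 0 \<Longrightarrow> 2 * pi / d * \<bar>of_int k\<bar> \<le> decay_rate d \<beta> k"
proof -
  show "\<beta> \<le> decay_rate d \<beta> k"
    unfolding decay_rate_def by (rule real_le_rsqrt) simp
  show "2 * pi / d * \<bar>of_int k\<bar> \<le> decay_rate d \<beta> k" if "d > 0"
    unfolding decay_rate_def by (rule real_le_rsqrt) (simp add: power_mult_distrib power_divide)
qed

lemma decay_rate_pos: "\<beta> > 0 \<Longrightarrow> decay_rate d \<beta> k > 0"
  using decay_rate_ge(1)[of \<beta> d k] by linarith

lemma decay_rate_square: "(decay_rate d \<beta> k)\<^sup>2 = (2 * pi * of_int k / d)\<^sup>2 + \<beta>\<^sup>2"
  by (simp add: decay_rate_def)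

text \<open>The linear lower bound on the rate gives geometric decay in the absolute value of
  \<open>k\<close>, and the bound by \<open>\<beta>\<close> controls the denominator even at
  \<open>k = 0\<close>. Positivity of \<open>Y\<close> is essential: at height 0 only the
  reciprocals of the rates would remain, and their sum diverges like a harmonic series.\<close>

lemma summable_on_exp_decay_rate:
  assumes d: "d > 0" and \<beta>: "\<beta> > 0" and Y: "Y > 0"
  shows "(\<lambda>k. exp (- decay_rate d \<beta> k * Y) / decay_rate d \<beta> k) summable_on UNIV"
proof (rule summable_on_comparison_test)
  show "(\<lambda>k::int. exp (- (2 * pi / d * Y) * \<bar>of_int k\<bar>) * (1 / \<beta>)) summable_on UNIV"
    using d Y by (intro summable_on_cmult_left summable_on_exp_neg_abs) simp
  fix k :: int
  have "2 * pi / d * \<bar>of_int k\<bar> * Y \<le> decay_rate d \<beta> k * Y"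
    using decay_rate_ge(2)[OF d] Y by (intro mult_right_mono) auto
  then have "exp (- decay_rate d \<beta> k * Y) \<le> exp (- (2 * pi / d * Y) * \<bar>of_int k\<bar>)"
    by (simp add: algebra_simps)
  then have "exp (- decay_rate d \<beta> k * Y) * (1 / decay_rate d \<beta> k) \<le> exp (- (2 * pi / d * Y) * \<bar>of_int k\<bar>) * (1 / \<beta>)"
    using decay_rate_ge(1)[of \<beta> d k] \<beta> by (intro mult_mono) (auto simp: frac_le)
  then show "exp (- decay_rate d \<beta> k * Y) / decay_rate d \<beta> k \<le> exp (- (2 * pi / d * Y) * \<bar>of_int k\<bar>) * (1 / \<beta>)"
    by simp
  show "0 \<le> exp (- decay_rate d \<beta> k * Y) / decay_rate d \<beta> k"
    using decay_rate_pos[OF \<beta>, of d k] by simp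
qed

theorem bessel_K0_poisson:
  assumes d: "d > 0" and \<beta>: "\<beta> > 0" and Y: "Y > 0"
  shows "((\<lambda>m::int. complex_of_real (bessel_K0 (\<beta> * sqrt ((X - of_int m * d)\<^sup>2 + Y\<^sup>2)))) has_sum
    (\<Sum>\<^sub>\<infinity>k. of_real (pi / d * (exp (- decay_rate d \<beta> k * Y) / decay_rate d \<beta> k)) * cis (2 * pi * of_int k * X / d))) UNIV"
proof -
  define W where "W v = exp (- \<beta>\<^sup>2 * exp v - Y\<^sup>2 / 4 * exp (- v))" for v
  define a where "a v = d\<^sup>2 * exp (- v) / 4" for v :: real
  have a: "a v > 0" for v
    using d by (simp add: a_def)
  define f where "f m v = exp (- \<beta>\<^sup>2 * exp v - (sqrt ((X - of_int m * d)\<^sup>2 + Y\<^sup>2))\<^sup>2 / 4 * exp (- v))" for m :: int and v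
  have f_eq: "f m v = W v * exp (- a v * (X / d - of_int m)\<^sup>2)" for m v
  proof -
    have "d * (X / d - of_int m) = X - of_int m * d"
      using d by (simp add: field_simps)
    then have "a v * (X / d - of_int m)\<^sup>2 = (X - of_int m * d)\<^sup>2 * exp (- v) / 4"
      unfolding a_def by (simp flip: power_mult_distrib)
    then show ?thesis
      by (simp add: f_def W_def exp_add[symmetric] algebra_simps add_divide_distrib)
  qed
  have intf: "has_bochner_integral lborel (f m) (2 * bessel_K0 (\<beta> * sqrt ((X - of_int m * d)\<^sup>2 + Y\<^sup>2)))" for m
    unfolding f_def using \<beta> Y by (intro has_bochner_integral_heat_bessel_K0) (auto simp: sum_power2_gt_zero_iff)
  define w where "w k v = 2 * sqrt pi / d * (exp (v / 2) * exp (- (decay_rate d \<beta> k)\<^sup>2 * exp v - Y\<^sup>2 / 4 * exp (- v)))" for k v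
  define e where "e k v = of_real (w k v) * cis (2 * pi * of_int k * X / d)" for k :: int and v
  \<comment> \<open>Here \<open>decay_rate\<close> originates: the transformed Gaussian contributes
    \<open>(2 * pi * k / d)^2 * exp v\<close>, which joins the term \<open>\<beta>^2 * exp v\<close>
    of \<open>W v\<close> to form the squared rate.\<close>
  have w_eq: "w k v = W v * (sqrt (pi / a v) * exp (- (pi * of_int k)\<^sup>2 / a v))" for k v
  proof -
    have "pi / a v = pi * (2 * exp (v / 2) / d)\<^sup>2"
      using d by (simp add: a_def exp_minus field_simps power2_eq_square flip: exp_add)
    then have "sqrt (pi / a v) = 2 * sqrt pi / d * exp (v / 2)"
      using d by (simp add: real_sqrt_mult)
    moreover have "(pi * of_int k)\<^sup>2 / a v = (2 * pi * of_int k / d)\<^sup>2 * exp v"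
      using d by (simp add: a_def exp_minus field_simps power2_eq_square)
    ultimately show ?thesis
      by (simp add: w_def W_def decay_rate_square exp_add[symmetric] algebra_simps)
  qed
  have intw: "has_bochner_integral lborel (w k) (2 * (pi / d * (exp (- decay_rate d \<beta> k * Y) / decay_rate d \<beta> k)))" for k
  proof -
    let ?E = "exp (- decay_rate d \<beta> k * Y)"
    have "2 * sqrt pi / d * (sqrt pi * ?E / decay_rate d \<beta> k) = 2 * (sqrt pi * sqrt pi) * ?E / (d * decay_rate d \<beta> k)"
      by simp
    also have "\<dots> = 2 * (pi / d * (?E / decay_rate d \<beta> k))"
      by (simp only: real_sqrt_mult_self) simp
    finally show ?thesis
      using has_bochner_integral_mult_right[OF has_bochner_integral_heat_exp_half[OF decay_rate_pos[OF \<beta>, of d k] Y], of "2 * sqrt pi / d"]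
      unfolding w_def[abs_def] by (simp only:)
  qed
  have w_pos: "w k v > 0" for k v
    using d by (simp add: w_def)
  have inte: "has_bochner_integral lborel (e k)
      (of_real (2 * (pi / d * (exp (- decay_rate d \<beta> k * Y) / decay_rate d \<beta> k))) * cis (2 * pi * of_int k * X / d))" for k
    unfolding e_def[abs_def] by (intro has_bochner_integral_mult_left has_bochner_integral_of_real intw)
  have norm_e: "norm (e k v) = w k v" for k v
    using w_pos[of k v] by (simp add: e_def norm_mult)
  define S where "S v = (\<Sum>\<^sub>\<infinity>k. e k v)" for v
  have f_sum: "((\<lambda>m. of_real (f m v)) has_sum S v) UNIV" for v
  proof -
    have "((\<lambda>m. of_real (W v) * of_real (exp (- a v * (X / d - of_int m)\<^sup>2))) has_sum
      of_real (W v) * (\<Sum>\<^sub>\<infinity>k::int. of_real (sqrt (pi / a v) * exp (- (pi * of_int k)\<^sup>2 / a v)) * cis (2 * pi * of_int k * (X / d)))) UNIV"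
      by (intro has_sum_cmult_right gaussian_poisson a)
    then show ?thesis
      by (simp add: f_eq S_def e_def w_eq mult.assoc flip: infsum_cmult_right')
  qed
  then have Re_sum: "((\<lambda>m. f m v) has_sum Re (S v)) UNIV" for v
    using has_sum_Re by fastforce
  have pointwise: "(\<lambda>k. norm (e k v)) summable_on UNIV" for v
  proof -
    have "(\<lambda>k::int. W v * (sqrt (pi / a v) * exp (- (pi\<^sup>2 / a v) * (of_int k)\<^sup>2))) summable_on UNIV"
      using a by (intro summable_on_cmult_right summable_on_gaussian_int) simp
    then show ?thesis
      by (simp add: norm_e w_eq power_mult_distrib)
  qed
  have norms: "(\<lambda>k. \<integral>v. norm (e k v) \<partial>lborel) summable_on UNIV"
    unfolding norm_e has_bochner_integral_integral_eq[OF intw]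
    by (intro summable_on_cmult_right summable_on_exp_decay_rate d \<beta> Y)
  have "integrable lborel (e k)" for k
    using inte by (simp add: has_bochner_integral_iff)
  then have S: "integrable lborel S" "((\<lambda>k. \<integral>v. e k v \<partial>lborel) has_sum (\<integral>v. S v \<partial>lborel)) UNIV"
    unfolding S_def[abs_def] using pointwise norms
    by (auto intro: integrable_infsum_int has_sum_integral_int)
  have S_real: "S v = of_real (Re (S v))" for v
    using has_sum_of_real[OF Re_sum, of v] f_sum[of v] has_sum_unique by blast
  \<comment> \<open>Both expansions have the same sum \<open>S v\<close>. Its integrability comes
    from the absolutely convergent frequency side and is exactly what the interchange for the
    nonnegative terms \<open>f m\<close> requires.\<close>
  have "integrable lborel (\<lambda>v. Re (S v))"
    using S(1) by simp
  then have "((\<lambda>m. \<integral>v. f m v \<partial>lborel) has_sum (\<integral>v. Re (S v) \<partial>lborel)) UNIV"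
    using intf by (intro has_sum_integral_nonneg Re_sum)
      (auto simp: has_bochner_integral_iff f_def intro: borel_measurable_integrable)
  then have "((\<lambda>m. complex_of_real (\<integral>v. f m v \<partial>lborel)) has_sum of_real (\<integral>v. Re (S v) \<partial>lborel)) UNIV"
    by (rule has_sum_of_real)
  moreover have "of_real (\<integral>v. Re (S v) \<partial>lborel) = (\<integral>v. S v \<partial>lborel)"
    by (subst (2) S_real) simp
  ultimately have "((\<lambda>m. of_real (1 / 2) * complex_of_real (\<integral>v. f m v \<partial>lborel)) has_sum
      of_real (1 / 2) * (\<Sum>\<^sub>\<infinity>k. \<integral>v. e k v \<partial>lborel)) UNIV"
    using infsumI[OF S(2)] by (intro has_sum_cmult_right) simp
  moreover have half: "of_real (1 / 2) * complex_of_real (2 * r) = of_real r"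
    "of_real (1 / 2) * (complex_of_real (2 * r) * z) = of_real r * z" for r z
    by simp_all
  ultimately show ?thesis
    unfolding has_bochner_integral_integral_eq[OF intf] has_bochner_integral_integral_eq[OF inte]
    by (simp only: half flip: infsum_cmult_right')
qed

section \<open>The southern image sources\<close>

lemma exp_eq_cis:
  "exp (2 * complex_of_real pi * \<i> * of_int m * complex_of_real u / complex_of_real d) = cis (2 * pi * of_int m * u / d)"
  "exp (4 * complex_of_real pi * \<i> * of_int m * complex_of_real u / complex_of_real d) = cis (2 * pi * of_int m * (2 * u) / d)"
  "exp (- 2 * complex_of_real pi * \<i> * of_int m * complex_of_real u / complex_of_real d) = cis (2 * pi * of_int m * (- u) / d)"
  by (simp_all add: cis_conv_exp mult_ac)

lemma summable_on_exp_atMost: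
  assumes "c > 0"
  shows "(\<lambda>n::int. exp (- c * of_int (- 2 - n)) :: real) summable_on {..-2}"
proof -
  \<comment> \<open>On this range \<open>- 2 - n\<close> is the absolute value of \<open>n\<close>
    less 2, whence the factor \<open>exp (2 * c)\<close>.\<close>
  have "(\<lambda>n::int. exp (2 * c) * exp (- c * \<bar>of_int n\<bar>)) summable_on {..-2}"
    using summable_on_cmult_right[OF summable_on_exp_neg_abs[OF assms]] by (rule summable_on_subset) auto
  then show ?thesis
    by (rule summable_on_cong[THEN iffD1, rotated]) (auto simp: algebra_simps simp flip: exp_add)
qed

text \<open>The exponent counts the rows below the nearest one, so \<open>n = - 2\<close>
  corresponds to the power 0.\<close>

lemma has_sum_geometric_atMost:
  fixes \<rho> :: complex
  assumes "norm \<rho> < 1"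
  shows "((\<lambda>n::int. \<rho> ^ nat (- 2 - n)) has_sum 1 / (1 - \<rho>)) {..-2}"
proof -
  have "((\<lambda>p. \<rho> ^ p) has_sum 1 / (1 - \<rho>)) UNIV"
    using assms by (intro norm_summable_imp_has_sum geometric_sums) (simp_all add: norm_power summable_geometric)
  then show ?thesis
    by (rule has_sum_reindex_bij_witness[where i = "\<lambda>n. nat (- 2 - n)" and j = "\<lambda>p. - 2 - int p", THEN iffD1, rotated -1]) auto
qed

lemma green_fun_lattice:
  "green_fun \<beta> t (s + lattice_vec d \<xi> \<eta> m n) = 1 / (2 * pi) *
     bessel_K0 (\<beta> * sqrt ((fst t - fst s - of_int n * \<xi> - of_int m * d)\<^sup>2 + (snd t - snd s - of_int n * \<eta>)\<^sup>2))"
  by (cases t; cases s) (simp add: green_fun_def lattice_vec_def basis1_def basis2_def norm_Pair algebra_simps)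

text \<open>The hypothesis on the heights puts row \<open>- 2\<close> at least \<open>\<eta>\<close>
  below the target and each further row another \<open>\<eta>\<close> lower. The plane-wave
  coefficients are then absolutely summable over rows and frequencies jointly, so they may be summed
  over the rows first.\<close>

lemma
  fixes d \<xi> \<eta> \<beta> :: real and s t :: "real \<times> real"
  assumes d: "d > 0" and \<eta>: "\<eta> > 0" and \<beta>: "\<beta> > 0" and st: "snd t - snd s \<ge> - \<eta>"
  shows summable_green_south:
      "(\<lambda>(m, n). green_fun \<beta> t (s + lattice_vec d \<xi> \<eta> m n)) summable_on (UNIV \<times> {..-2})"
    and has_sum_green_south:
      "((\<lambda>m. of_real (1 / (2 * d)) * (of_real (exp (- 2 * decay_rate d \<beta> m * \<eta>)) * cis (2 * pi * of_int m * (2 * \<xi>) / d) /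
          (1 - of_real (exp (- decay_rate d \<beta> m * \<eta>)) * cis (2 * pi * of_int m * \<xi> / d))) *
          (of_real (exp (decay_rate d \<beta> m * snd s)) * cis (2 * pi * of_int m * (- fst s) / d) / of_real (decay_rate d \<beta> m)) *
          of_real (exp (- decay_rate d \<beta> m * snd t)) * cis (2 * pi * of_int m * fst t / d))
        has_sum complex_of_real (\<Sum>\<^sub>\<infinity>m. \<Sum>\<^sub>\<infinity>n\<in>{..-2}. green_fun \<beta> t (s + lattice_vec d \<xi> \<eta> m n))) UNIV"
      (is "(?U has_sum _) _")
proof -
  define X where "X n = fst t - fst s - of_int n * \<xi>" for n :: int
  define Y where "Y n = snd t - snd s - of_int n * \<eta>" for n :: int
  define K where "K n m = green_fun \<beta> t (s + lattice_vec d \<xi> \<eta> m n)" for n m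
  define \<mu> where "\<mu> = decay_rate d \<beta>"
  define T where "T n k = of_real (1 / (2 * d) * (exp (- \<mu> k * Y n) / \<mu> k)) * cis (2 * pi * of_int k * X n / d)" for n k :: int
  have \<mu>: "\<mu> k > 0" "\<beta> \<le> \<mu> k" for k
    unfolding \<mu>_def using decay_rate_pos[OF \<beta>] decay_rate_ge(1) by auto
  have Y: "Y n \<ge> \<eta> + of_int (- 2 - n) * \<eta>" for n
    using st by (simp add: Y_def algebra_simps)
  have Y_pos: "Y n > 0" if "n \<le> - 2" for n
  proof -
    have "of_int (- 2 - n) * \<eta> \<ge> 0"
      using that \<eta> by (intro mult_nonneg_nonneg) auto
    then show ?thesis using Y[of n] \<eta> by linarith
  qed
  have K_nonneg: "K n m \<ge> 0" for n m
    unfolding K_def green_fun_def bessel_K0_def set_lebesgue_integral_def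
    by (intro mult_nonneg_nonneg integral_nonneg) auto
  have K_sum: "((\<lambda>m. complex_of_real (K n m)) has_sum (\<Sum>\<^sub>\<infinity>k. T n k)) UNIV" if "n \<le> - 2" for n
  proof -
    have "((\<lambda>m. of_real (1 / (2 * pi)) * complex_of_real (bessel_K0 (\<beta> * sqrt ((X n - of_int m * d)\<^sup>2 + (Y n)\<^sup>2)))) has_sum
      of_real (1 / (2 * pi)) * (\<Sum>\<^sub>\<infinity>k. of_real (pi / d * (exp (- \<mu> k * Y n) / \<mu> k)) * cis (2 * pi * of_int k * X n / d))) UNIV"
      unfolding \<mu>_def by (intro has_sum_cmult_right bessel_K0_poisson d \<beta> Y_pos that)
    moreover have "of_real (1 / (2 * pi)) * (of_real (pi / d * (exp (- \<mu> k * Y n) / \<mu> k)) * cis (2 * pi * of_int k * X n / d)) = T n k" for k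
      by (simp add: T_def)
    moreover have "of_real (1 / (2 * pi)) * complex_of_real (bessel_K0 (\<beta> * sqrt ((X n - of_int m * d)\<^sup>2 + (Y n)\<^sup>2))) = of_real (K n m)" for m
      by (simp add: K_def green_fun_lattice X_def Y_def)
    ultimately show ?thesis
      by (simp only: flip: infsum_cmult_right')
  qed
  have T_summable: "(\<lambda>(n, k). T n k) summable_on {..-2} \<times> UNIV"
  proof -
    \<comment> \<open>The majorant is a product because the lower bound for \<open>Y n\<close> is
      split: the first \<open>\<eta>\<close> keeps the full rate \<open>\<mu> k\<close> and gives
      decay in \<open>k\<close>, while on the remaining \<open>- 2 - n\<close> multiples of
      \<open>\<eta>\<close> the rate is lowered to \<open>\<beta>\<close>, which gives decay in
      \<open>n\<close>.\<close>
    define B where "B k = exp (- \<mu> k * \<eta>) / \<mu> k" for k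
    define D where "D n = 1 / (2 * d) * exp (- (\<beta> * \<eta>) * of_int (- 2 - n))" for n :: int
    have B: "B summable_on UNIV"
      unfolding B_def \<mu>_def by (intro summable_on_exp_decay_rate d \<eta> \<beta>)
    have D: "D summable_on {..-2}"
      unfolding D_def using \<beta> \<eta> by (intro summable_on_cmult_right summable_on_exp_atMost) simp
    have nonneg: "B k \<ge> 0" "D n \<ge> 0" for k n
      using \<mu>[of k] d by (simp_all add: B_def D_def)
    have "(\<lambda>(n, k). D n * B k) summable_on {..-2} \<times> UNIV"
    proof (rule summable_on_SigmaI)
      show "((\<lambda>k. (case (n, k) of (n, k) \<Rightarrow> D n * B k)) has_sum D n * infsum B UNIV) UNIV" for n
        using B by (simp add: has_sum_cmult_right)
      show "(\<lambda>n. D n * infsum B UNIV) summable_on {..-2}"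
        by (intro summable_on_cmult_left D)
    qed (use nonneg in auto)
    then have "(\<lambda>p. norm (case p of (n, k) \<Rightarrow> T n k)) summable_on {..-2} \<times> UNIV"
    proof (rule summable_on_comparison_test)
      fix p :: "int \<times> int" assume "p \<in> {..-2} \<times> UNIV"
      then obtain n k where p: "p = (n, k)" and n: "n \<le> - 2" by auto
      have "\<mu> k * Y n \<ge> \<mu> k * (\<eta> + of_int (- 2 - n) * \<eta>)"
        using Y[of n] \<mu>[of k] by (intro mult_left_mono) auto
      moreover have "\<mu> k * (of_int (- 2 - n) * \<eta>) \<ge> \<beta> * (of_int (- 2 - n) * \<eta>)"
        using \<mu>[of k] n \<eta> by (intro mult_right_mono mult_nonneg_nonneg) auto
      ultimately have "exp (- \<mu> k * Y n) \<le> exp (- \<mu> k * \<eta>) * exp (- (\<beta> * \<eta>) * of_int (- 2 - n))"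
        unfolding exp_add[symmetric] by (simp add: algebra_simps)
      then have "exp (- \<mu> k * Y n) / (2 * d * \<mu> k) \<le> exp (- \<mu> k * \<eta>) * exp (- (\<beta> * \<eta>) * of_int (- 2 - n)) / (2 * d * \<mu> k)"
        using \<mu>[of k] d by (intro divide_right_mono) auto
      then show "norm (case p of (n, k) \<Rightarrow> T n k) \<le> (case p of (n, k) \<Rightarrow> D n * B k)"
        using \<mu>[of k] d by (simp add: p T_def B_def D_def norm_mult norm_divide mult_ac)
    qed auto
    then show ?thesis
      by (rule abs_summable_summable)
  qed
  then have T_has: "((\<lambda>(n, k). T n k) has_sum (\<Sum>\<^sub>\<infinity>(n, k)\<in>{..-2} \<times> UNIV. T n k)) ({..-2} \<times> UNIV)" (is "(_ has_sum ?tot) _")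
    by simp
  have T_row: "(T n has_sum (\<Sum>\<^sub>\<infinity>k. T n k)) UNIV" if "n \<le> - 2" for n
    using summable_on_SigmaD1[OF T_summable, of n] that by simp
  have rows: "((\<lambda>n. \<Sum>\<^sub>\<infinity>k. T n k) has_sum ?tot) {..-2}"
    by (rule has_sum_SigmaD[OF T_has]) (use T_row in auto)
  have K_real: "(K n has_sum Re (\<Sum>\<^sub>\<infinity>k. T n k)) UNIV" if "n \<le> - 2" for n
    using has_sum_Re[OF K_sum[OF that]] by simp
  \<comment> \<open>The terms are nonnegative, so summability of the row totals suffices for the
    pairs, and those totals are the real parts of the already summable plane-wave rows.\<close>
  have K_summable: "(\<lambda>(n, m). K n m) summable_on {..-2} \<times> UNIV"
  proof (rule summable_on_SigmaI)
    show "((\<lambda>m. (case (n, m) of (n, m) \<Rightarrow> K n m)) has_sum Re (\<Sum>\<^sub>\<infinity>k. T n k)) UNIV" if "n \<in> {..-2}" for n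
      using K_real that by simp
    show "(\<lambda>n. Re (\<Sum>\<^sub>\<infinity>k. T n k)) summable_on {..-2}"
      using rows by (intro summable_on_Re has_sum_imp_summable)
  qed (use K_nonneg in auto)
  then show "(\<lambda>(m, n). green_fun \<beta> t (s + lattice_vec d \<xi> \<eta> m n)) summable_on (UNIV \<times> {..-2})"
    by (subst (asm) summable_on_swap) (simp add: K_def)
  have "of_real (\<Sum>\<^sub>\<infinity>m. \<Sum>\<^sub>\<infinity>n\<in>{..-2}. K n m) = complex_of_real (\<Sum>\<^sub>\<infinity>n\<in>{..-2}. \<Sum>\<^sub>\<infinity>m. K n m)"
    by (subst infsum_swap_banach[OF K_summable]) simp
  also have "(\<Sum>\<^sub>\<infinity>n\<in>{..-2}. \<Sum>\<^sub>\<infinity>m. K n m) = (\<Sum>\<^sub>\<infinity>n\<in>{..-2}. Re (\<Sum>\<^sub>\<infinity>k. T n k))"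
    by (intro infsum_cong infsumI K_real) simp
  also have "complex_of_real \<dots> = (\<Sum>\<^sub>\<infinity>n\<in>{..-2}. of_real (Re (\<Sum>\<^sub>\<infinity>k. T n k)))"
    using has_sum_of_real[OF has_sum_infsum[OF summable_on_Re[OF has_sum_imp_summable[OF rows]]]]
    by (intro infsumI[symmetric])
  also have "\<dots> = (\<Sum>\<^sub>\<infinity>n\<in>{..-2}. \<Sum>\<^sub>\<infinity>k. T n k)"
    by (intro infsum_cong has_sum_unique[OF has_sum_of_real[OF K_real] K_sum]) auto
  also have "\<dots> = ?tot"
    using rows by (rule infsumI)
  finally have tot: "complex_of_real (\<Sum>\<^sub>\<infinity>m. \<Sum>\<^sub>\<infinity>n\<in>{..-2}. green_fun \<beta> t (s + lattice_vec d \<xi> \<eta> m n)) = ?tot"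
    by (simp only: K_def)
  \<comment> \<open>At a fixed frequency, moving one row down raises \<open>Y\<close> by
    \<open>\<eta>\<close> and \<open>X\<close> by \<open>\<xi>\<close>, which multiplies the term by
    the constant \<open>\<rho>\<close>.\<close>
  have col: "((\<lambda>n. T n k) has_sum ?U k) {..-2}" for k
  proof -
    define \<rho> where "\<rho> = of_real (exp (- \<mu> k * \<eta>)) * cis (2 * pi * of_int k * \<xi> / d)"
    have "norm \<rho> < 1"
      using \<mu>[of k] \<eta> by (simp add: \<rho>_def norm_mult)
    then have "((\<lambda>n. T (- 2) k * \<rho> ^ nat (- 2 - n)) has_sum T (- 2) k * (1 / (1 - \<rho>))) {..-2}"
      by (intro has_sum_cmult_right has_sum_geometric_atMost)
    moreover have "T (- 2) k * \<rho> ^ nat (- 2 - n) = T n k" if "n \<le> - 2" for n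
    proof -
      define p where "p = nat (- 2 - n)"
      have n: "n = - 2 - int p"
        using that by (simp add: p_def)
      have "\<rho> ^ p = of_real (exp (of_nat p * (- \<mu> k * \<eta>))) * cis (of_nat p * (2 * pi * of_int k * \<xi> / d))"
        by (simp only: \<rho>_def power_mult_distrib Complex.DeMoivre exp_of_nat_mult of_real_power)
      moreover have "exp (- \<mu> k * Y n) = exp (- \<mu> k * Y (- 2)) * exp (of_nat p * (- \<mu> k * \<eta>))"
        unfolding exp_add[symmetric] by (simp add: Y_def n algebra_simps)
      moreover have "cis (2 * pi * of_int k * X n / d) = cis (2 * pi * of_int k * X (- 2) / d) * cis (of_nat p * (2 * pi * of_int k * \<xi> / d))"
        unfolding cis_mult using d by (simp add: X_def n field_simps)
      ultimately show ?thesis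
        by (simp add: T_def flip: p_def)
    qed
    moreover have "T (- 2) k * (1 / (1 - \<rho>)) = ?U k"
    proof -
      \<comment> \<open>The leading term of the geometric series belongs to row \<open>- 2\<close>;
        it accounts for the doubled \<open>\<eta>\<close> here and the doubled \<open>\<xi>\<close>
        in the phase, and it splits into a source factor and a target factor.\<close>
      have "exp (- \<mu> k * Y (- 2)) = exp (- 2 * \<mu> k * \<eta>) * exp (\<mu> k * snd s) * exp (- \<mu> k * snd t)"
        unfolding exp_add[symmetric] by (simp add: Y_def algebra_simps)
      moreover have "cis (2 * pi * of_int k * X (- 2) / d) = cis (2 * pi * of_int k * (2 * \<xi>) / d)
          * cis (2 * pi * of_int k * (- fst s) / d) * cis (2 * pi * of_int k * fst t / d)"
        unfolding cis_mult using d by (simp add: X_def field_simps)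
      ultimately show ?thesis
        unfolding T_def \<rho>_def[symmetric] \<mu>_def[symmetric] by (simp add: \<rho>_def \<mu>_def mult_ac)
    qed
    ultimately show ?thesis
      by (subst has_sum_cong[where g = "\<lambda>n. T (- 2) k * \<rho> ^ nat (- 2 - n)"]) auto
  qed
  have "((\<lambda>(k, n). T n k) has_sum ?tot) (UNIV \<times> {..-2})"
    using T_has by (subst has_sum_swap) (simp add: case_prod_unfold)
  then have "(?U has_sum ?tot) UNIV"
    by (rule has_sum_SigmaD) (use col in simp)
  then show "(?U has_sum complex_of_real (\<Sum>\<^sub>\<infinity>m. \<Sum>\<^sub>\<infinity>n\<in>{..-2}. green_fun \<beta> t (s + lattice_vec d \<xi> \<eta> m n))) UNIV"
    unfolding tot .
qed

text \<open>The first basis vector is horizontal, so only the coefficient of the second affects the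
  height. Two points of the cell thus differ in height by at most \<open>\<eta>\<close>.\<close>

lemma abs_snd_unit_cell_le:
  assumes p: "p \<in> unit_cell d \<xi> \<eta>" and \<eta>: "\<eta> > 0"
  shows "\<bar>snd p\<bar> \<le> \<eta> / 2"
proof -
  from p obtain u where u: "snd p = u * \<eta>" "u \<in> {-1/2..1/2}"
    unfolding unit_cell_def basis1_def basis2_def by fastforce
  then have "\<bar>u\<bar> * \<eta> \<le> 1 / 2 * \<eta>"
    using \<eta> by (intro mult_right_mono) auto
  then show ?thesis
    using u \<eta> by (simp add: abs_mult)
qed

lemma has_sum_sum:
  fixes f :: "'a \<Rightarrow> 'b \<Rightarrow> 'c :: topological_comm_monoid_add"
  assumes "finite J" and "\<And>j. j \<in> J \<Longrightarrow> (f j has_sum S j) A"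
  shows "((\<lambda>m. \<Sum>j\<in>J. f j m) has_sum (\<Sum>j\<in>J. S j)) A"
  using assms by (induction J rule: finite_induct) (auto intro: has_sum_add)

text \<open>An infinite sum over a non-summable family is 0 by convention, so the two summability
  clauses are what gives the sums in the equation their usual meaning.\<close>

theorem claim1:
  fixes d \<xi> \<eta> \<beta> :: real
    and N :: nat
    and s :: "nat \<Rightarrow> real \<times> real"
    and q :: "nat \<Rightarrow> real"
    and x y :: real
  assumes "d > 0" and "\<eta> > 0" and "d \<ge> sqrt (\<xi>\<^sup>2 + \<eta>\<^sup>2)"
    and "\<beta> > 0"
    and "\<And>j. j \<in> {1..N} \<Longrightarrow> s j \<in> unit_cell d \<xi> \<eta>"
    and "(x, y) \<in> unit_cell d \<xi> \<eta>"
  shows "(\<forall>j\<in>{1..N}. (\<lambda>(m, n). green_fun \<beta> (x, y) (s j + lattice_vec d \<xi> \<eta> m n))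
            summable_on (UNIV \<times> {..-2}))
    \<and> (\<lambda>m::int. south_coeff d \<xi> \<eta> \<beta> N s q m * complex_of_real (exp (- decay_rate d \<beta> m * y)) *
           exp (2 * complex_of_real pi * \<i> * of_int m * complex_of_real x / complex_of_real d))
         summable_on UNIV
    \<and> complex_of_real
        (\<Sum>j=1..N. (\<Sum>\<^sub>\<infinity>m::int. \<Sum>\<^sub>\<infinity>n\<in>{..-2::int}.
            green_fun \<beta> (x, y) (s j + lattice_vec d \<xi> \<eta> m n)) * q j)
      = (\<Sum>\<^sub>\<infinity>m::int. south_coeff d \<xi> \<eta> \<beta> N s q m * complex_of_real (exp (- decay_rate d \<beta> m * y)) *
           exp (2 * complex_of_real pi * \<i> * of_int m * complex_of_real x / complex_of_real d))"
proof -
  have gap: "snd (x, y) - snd (s j) \<ge> - \<eta>" if "j \<in> {1..N}" for j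
    using abs_snd_unit_cell_le[OF assms(5)[OF that] assms(2)] abs_snd_unit_cell_le[OF assms(6,2)] by (simp add: abs_le_iff)
  define U where "U j m = of_real (1 / (2 * d)) * (of_real (exp (- 2 * decay_rate d \<beta> m * \<eta>)) * cis (2 * pi * of_int m * (2 * \<xi>) / d) /
      (1 - of_real (exp (- decay_rate d \<beta> m * \<eta>)) * cis (2 * pi * of_int m * \<xi> / d))) *
      (of_real (exp (decay_rate d \<beta> m * snd (s j))) * cis (2 * pi * of_int m * (- fst (s j)) / d) / of_real (decay_rate d \<beta> m)) *
      of_real (exp (- decay_rate d \<beta> m * y)) * cis (2 * pi * of_int m * x / d)" for j m
  let ?K = "\<lambda>j. \<Sum>\<^sub>\<infinity>m::int. \<Sum>\<^sub>\<infinity>n\<in>{..-2::int}. green_fun \<beta> (x, y) (s j + lattice_vec d \<xi> \<eta> m n)"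
  have "(U j has_sum complex_of_real (?K j)) UNIV" if "j \<in> {1..N}" for j
    using has_sum_green_south[OF assms(1,2,4) gap[OF that], of \<xi>] unfolding U_def[abs_def] fst_conv snd_conv .
  then have "((\<lambda>m. \<Sum>j=1..N. U j m * of_real (q j)) has_sum (\<Sum>j=1..N. complex_of_real (?K j) * of_real (q j))) UNIV"
    by (intro has_sum_sum has_sum_cmult_left) auto
  moreover have "(\<Sum>j=1..N. U j m * of_real (q j)) = south_coeff d \<xi> \<eta> \<beta> N s q m * complex_of_real (exp (- decay_rate d \<beta> m * y)) *
      exp (2 * complex_of_real pi * \<i> * of_int m * complex_of_real x / complex_of_real d)" for m
    unfolding south_coeff_def exp_eq_cis U_def sum_distrib_left sum_distrib_right
    by (intro sum.cong refl) (simp add: mult_ac)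
  moreover have "(\<Sum>j=1..N. complex_of_real (?K j) * of_real (q j)) = complex_of_real (\<Sum>j=1..N. ?K j * q j)"
    by simp
  ultimately have main: "((\<lambda>m. south_coeff d \<xi> \<eta> \<beta> N s q m * complex_of_real (exp (- decay_rate d \<beta> m * y)) *
      exp (2 * complex_of_real pi * \<i> * of_int m * complex_of_real x / complex_of_real d)) has_sum
      complex_of_real (\<Sum>j=1..N. ?K j * q j)) UNIV"
    by (simp only:)
  show ?thesis
    using summable_green_south[OF assms(1,2,4) gap] has_sum_imp_summable[OF main] infsumI[OF main, symmetric] by blast
qed

end
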